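(* Let $k\ge 4$ and $n\ge k$ be integers, and let $G$ be a connected $k$-chromatic graph of order $n$ with $G\notin\mathcal{C}^*_k(n)$. Then $$\frac{1}{(x)_{\downarrow k}}\,\pi(G,x)<(x-1)^{n-k}$$ for every real number $x> n-2+\left(\binom{n}{2}-\binom{k}{2}-n+k\right)^2$.
   Context: All graphs are finite and simple. $\pi(G,x)$ denotes the chromatic polynomial of $G$. $(x)_{\downarrow k}=x(x-1)\cdots(x-k+1)$ is the falling factorial. A graph is $k$-chromatic if its chromatic number is $k$. $\mathcal{C}^*_k(n)$ denotes the set of connected $k$-chromatic graphs of order $n$ that have exactly $\binom{k}{2}+n-k$ edges and clique number $k$ (equivalently, graphs obtained from $K_k$ by repeatedly attaching a new vertex of degree one). *)

theory Defs
  imports Complex_Main "HOL-Library.FuncSet" "HOL-Library.Ramsey" "HOL-Computational_Algebra.Polynomial"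
begin

locale simple_graph =
  fixes V :: "'a set" and E :: "'a set set"
  assumes finite_verts: "finite V"
    and edges_doubletons: "\<And>e. e \<in> E \<Longrightarrow> e \<subseteq> V \<and> card e = 2"

definition connected_graph :: "'a set \<Rightarrow> 'a set set \<Rightarrow> bool" where
  "connected_graph V E \<longleftrightarrow>
     V \<noteq> {} \<and> (\<forall>u\<in>V. \<forall>v\<in>V. (u, v) \<in> {(a, b). {a, b} \<in> E}\<^sup>*)"

definition proper_colourings :: "'a set \<Rightarrow> 'a set set \<Rightarrow> nat \<Rightarrow> ('a \<Rightarrow> nat) set" where
  "proper_colourings V E q =
     {f \<in> V \<rightarrow>\<^sub>E {..<q}. \<forall>u v. {u, v} \<in> E \<longrightarrow> f u \<noteq> f v}"

definition chromatic_number :: "'a set \<Rightarrow> 'a set set \<Rightarrow> nat" where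
  "chromatic_number V E = (LEAST q. proper_colourings V E q \<noteq> {})"

definition clique_number :: "'a set \<Rightarrow> 'a set set \<Rightarrow> nat" where
  "clique_number V E = Max (card ` {K. K \<subseteq> V \<and> clique K E})"

text \<open>
  The chromatic polynomial is the polynomial interpolating the numbers of proper
  colourings with \<open>q\<close> colours; existence and uniqueness are established in
  \<open>ex1_chromatic_poly\<close> below.
\<close>

definition chromatic_poly :: "'a set \<Rightarrow> 'a set set \<Rightarrow> real poly" where
  "chromatic_poly V E =
     (THE p. \<forall>q. poly p (real q) = real (card (proper_colourings V E q)))"

definition falling_factorial :: "real \<Rightarrow> nat \<Rightarrow> real" where
  "falling_factorial x k = (\<Prod>i<k. x - real i)"

text \<open>
  The subtraction of natural numbers below is not truncated: the chromatic number \<open>k\<close> of a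
  simple graph is at most its order \<open>n\<close>.
\<close>

definition Cstar :: "nat \<Rightarrow> nat \<Rightarrow> ('a set \<times> 'a set set) set" where
  "Cstar k n = {(V, E). simple_graph V E \<and> connected_graph V E \<and> chromatic_number V E = k \<and>
     card V = n \<and> card E = (k choose 2) + n - k \<and> clique_number V E = k}"

text \<open>
  Well-definedness of \<open>chromatic_poly\<close>. Existence is proved by deletion and contraction,
  for arbitrary finite sets \<open>R\<close> of pairs of vertices that must receive distinct colours.
\<close>

lemma colourings_poly_ex:
  fixes V :: "'a set" and R :: "('a \<times> 'a) set"
  assumes "finite V" "finite R" "R \<subseteq> V \<times> V"
  shows "\<exists>p :: real poly. \<forall>q.
     poly p (real q) = real (card {f \<in> V \<rightarrow>\<^sub>E {..<q}. \<forall>(u, v)\<in>R. f u \<noteq> f v})"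
  using assms
proof (induction "card R" arbitrary: V R rule: less_induct)
  case less
  let ?C = "\<lambda>V R q. {f \<in> V \<rightarrow>\<^sub>E {..<q::nat}. \<forall>(u, v)\<in>R. f u \<noteq> f v}"
  have finC: "finite (?C V' R' q)" if "finite V'" for V' :: "'a set" and R' q
    by (rule finite_subset[OF _ finite_PiE[OF that, of "\<lambda>_. {..<q}"]]) auto
  show ?case
  proof (cases "R = {}")
    case True
    have "poly (monom 1 (card V)) (real q) = real (card (?C V R q))" for q
      using less.prems True by (simp add: card_PiE poly_monom)
    then show ?thesis by blast
  next
    case False
    then obtain u v where uv: "(u, v) \<in> R" by auto
    define R0 where "R0 = R - {(u, v)}"
    have R: "R = insert (u, v) R0" "R0 \<subseteq> V \<times> V" "finite R0" and c0: "card R0 < card R"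
      using uv less.prems card_Diff1_less[of R "(u, v)"] by (auto simp: R0_def)
    have V: "u \<in> V" "v \<in> V" using uv less.prems by auto
    show ?thesis
    proof (cases "u = v")
      case True
      then have C: "?C V R q = {}" for q using uv by auto
      have "poly 0 (real q) = real (card (?C V R q))" for q unfolding C by simp
      then show ?thesis by blast
    next
      case neq: False
      define h where "h = (\<lambda>w. if w = v then u else w)"
      define R1 where "R1 = map_prod h h ` R0"
      have c1: "card R1 < card R"
        using c0 card_image_le[OF R(3), of "map_prod h h"] by (simp add: R1_def)
      have R1: "R1 \<subseteq> (V - {v}) \<times> (V - {v})" "finite R1"
        using R V neq by (auto simp: R1_def h_def split: if_splits)
      obtain p0 where p0: "\<forall>q. poly p0 (real q) = real (card (?C V R0 q))"
        by (rule exE[OF less.hyps[OF c0 less.prems(1) R(3,2)]])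
      obtain p1 where p1: "\<forall>q. poly p1 (real q) = real (card (?C (V - {v}) R1 q))"
        by (rule exE[OF less.hyps[OF c1 finite_Diff[OF less.prems(1)] R1(2,1)]])
      have "poly (p0 - p1) (real q) = real (card (?C V R q))" for q
      proof -
        let ?D = "{f \<in> ?C V R0 q. f u = f v}"
        have "bij_betw (\<lambda>f. f(v := undefined)) ?D (?C (V - {v}) R1 q)"
        proof (rule bij_betw_byWitness[where f' = "\<lambda>g. g(v := g u)"])
          show "\<forall>f\<in>?D. (f(v := undefined))(v := (f(v := undefined)) u) = f"
            using neq by (auto simp: fun_eq_iff)
          show "\<forall>g\<in>?C (V - {v}) R1 q. (g(v := g u))(v := undefined) = g"
            by (auto simp: fun_eq_iff PiE_def extensional_def)
          show "(\<lambda>f. f(v := undefined)) ` ?D \<subseteq> ?C (V - {v}) R1 q"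
          proof (rule image_subsetI)
            fix f assume f: "f \<in> ?D"
            have fh: "(f(v := undefined)) (h w) = f w" for w
              using f neq by (simp add: h_def)
            have "f a \<noteq> f b" if "(a, b) \<in> R0" for a b
              using f that by blast
            then have "\<forall>(a, b)\<in>R1. (f(v := undefined)) a \<noteq> (f(v := undefined)) b"
              unfolding R1_def by (auto simp only: map_prod_simp fh)
            moreover have "f(v := undefined) \<in> V - {v} \<rightarrow>\<^sub>E {..<q}"
              using f by (auto simp: PiE_def extensional_def Pi_def)
            ultimately show "f(v := undefined) \<in> ?C (V - {v}) R1 q" by blast
          qed
          show "(\<lambda>g. g(v := g u)) ` ?C (V - {v}) R1 q \<subseteq> ?D"
          proof (rule image_subsetI)
            fix g assume g: "g \<in> ?C (V - {v}) R1 q"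
            have gh: "(g(v := g u)) w = g (h w)" for w
              by (simp add: h_def)
            have "g (h a) \<noteq> g (h b)" if "(a, b) \<in> R0" for a b
            proof -
              have "(h a, h b) \<in> R1" using imageI[OF that, of "map_prod h h"] by (simp add: R1_def)
              then show ?thesis using g by blast
            qed
            then have "\<forall>(a, b)\<in>R0. (g(v := g u)) a \<noteq> (g(v := g u)) b"
              unfolding gh by blast
            moreover have "g(v := g u) \<in> V \<rightarrow>\<^sub>E {..<q}"
              using g V neq by (auto simp: PiE_def extensional_def Pi_def)
            moreover have "(g(v := g u)) u = (g(v := g u)) v" by simp
            ultimately show "g(v := g u) \<in> ?D" by blast
          qed
        qed
        then have card_D: "card ?D = card (?C (V - {v}) R1 q)" by (rule bij_betw_same_card)
        have split: "?C V R0 q = ?C V R q \<union> ?D" and disj: "?C V R q \<inter> ?D = {}"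
          using R(1) by auto
        have "finite (?C V R0 q)" "finite (?C V R q)"
          by (rule finC[OF less.prems(1)])+
        then have "card (?C V R q \<union> ?D) = card (?C V R q) + card ?D"
          by (intro card_Un_disjoint[OF _ _ disj]) (auto intro: rev_finite_subset)
        from trans[OF arg_cong[OF split, of card] this]
        have "card (?C V R0 q) = card (?C V R q) + card ?D" .
        then have "card (?C V R0 q) = card (?C V R q) + card (?C (V - {v}) R1 q)"
          unfolding card_D .
        then show ?thesis using p0 p1 by simp
      qed
      then show ?thesis by blast
    qed
  qed
qed

lemma poly_eq_of_nat_values:
  fixes p p' :: "real poly"
  assumes "\<And>q::nat. poly p (real q) = poly p' (real q)"
  shows "p = p'"
proof (rule ccontr)
  assume "p \<noteq> p'"
  then have "finite {x. poly (p - p') x = 0}" by (intro poly_roots_finite) simp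
  moreover have "range real \<subseteq> {x. poly (p - p') x = 0}" using assms by auto
  ultimately have "finite (range real)" by (rule rev_finite_subset)
  then show False by (simp add: finite_image_iff)
qed

lemma ex1_chromatic_poly:
  assumes "simple_graph V E"
  shows "\<exists>!p :: real poly. \<forall>q. poly p (real q) = real (card (proper_colourings V E q))"
proof -
  interpret simple_graph V E by fact
  define R where "R = {(u, v). {u, v} \<in> E}"
  have R: "R \<subseteq> V \<times> V" using edges_doubletons by (auto simp: R_def)
  then have "finite R" using finite_verts by (meson finite_SigmaI finite_subset)
  from colourings_poly_ex[OF finite_verts this R] show ?thesis
    unfolding proper_colourings_def R_def
    by (auto intro!: poly_eq_of_nat_values)
qed

lemma poly_chromatic_poly:
  assumes "simple_graph V E"
  shows "poly (chromatic_poly V E) (real q) = real (card (proper_colourings V E q))"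
  using theI'[OF ex1_chromatic_poly[OF assms]] by (simp add: chromatic_poly_def)

end

theory Submission
  imports Defs
begin

text \<open>
  Expanding in falling factorials, \<open>\<pi>(G, x)\<close> is a sum of terms \<open>a j * (x)\<down>(n - j)\<close> over \<open>j \<le> n - k\<close>,
  where \<open>a j \<le> (M choose j)\<close> and \<open>M\<close> is the number of non-edges. After division by \<open>(x)\<down>k\<close>, the
  coefficient at \<open>j = 1\<close> is at most \<open>M\<close>, while for \<open>(x - 1) ^ (n - k)\<close> it is
  \<open>N = (n choose 2) - (k choose 2) - n + k\<close>. A connected \<open>k\<close>-chromatic graph outside \<open>Cstar\<close> has more
  than \<open>(k choose 2) + n - k\<close> edges, by the degree count in a vertex-critical subgraph, so \<open>M < N\<close>.
  For \<open>x - n + 2 > N\<^sup>2\<close> the terms with \<open>j \<ge> 2\<close> together do not make up for this difference.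
\<close>

section \<open>Chromatic number and cliques\<close>

lemma two_times_choose_two: "2 * (n choose 2) = n * (n - 1)"
proof -
  have "even (n * (n - 1))" by (cases n) auto
  then show ?thesis by (simp add: choose_two)
qed

text \<open>Numbering the vertices injectively gives a proper colouring with \<open>card V\<close>
  colours, so the \<open>LEAST\<close> in \<open>chromatic_number\<close> is attained.\<close>

lemma proper_colourings_chromatic_number:
  assumes "simple_graph V E"
  shows "proper_colourings V E (chromatic_number V E) \<noteq> {}"
proof -
  interpret simple_graph V E by fact
  obtain h where h: "bij_betw h V {0..<card V}"
    using ex_bij_betw_finite_nat[OF finite_verts] by blast
  have "h u \<noteq> h v" "u \<in> V" "v \<in> V" if "{u, v} \<in> E" for u v
  proof -
    have "{u, v} \<subseteq> V" "card {u, v} = 2" using edges_doubletons[OF that] by auto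
    moreover from this have "u \<noteq> v" by auto
    ultimately show "h u \<noteq> h v" "u \<in> V" "v \<in> V"
      using bij_betw_imp_inj_on[OF h] by (auto simp: inj_on_def)
  qed
  moreover have "h u < card V" if "u \<in> V" for u
    using bij_betwE[OF h] that by auto
  ultimately have "restrict h V \<in> proper_colourings V E (card V)"
    unfolding proper_colourings_def by auto
  then show ?thesis
    unfolding chromatic_number_def by (metis (mono_tags, lifting) LeastI_ex empty_iff)
qed

context simple_graph
begin

lemma edgeD:
  assumes "{u, v} \<in> E"
  shows "u \<in> V" "v \<in> V" "u \<noteq> v"
  using edges_doubletons[OF assms] by auto

lemma finite_edges: "finite E"
  using edges_doubletons finite_verts
  by (intro finite_subset[of E "Pow V"]) auto

text \<open>A proper colouring is injective on every clique, so no clique can be larger than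
  \<open>K\<close>. This supplies the clique condition of \<open>Cstar\<close>.\<close>

lemma clique_number_eqI:
  assumes "clique K E" "K \<subseteq> V" "card K = chromatic_number V E"
  shows "clique_number V E = chromatic_number V E"
  unfolding clique_number_def
proof (rule Max_eqI)
  show "finite (card ` {K. K \<subseteq> V \<and> clique K E})"
    using finite_verts by auto
  show "chromatic_number V E \<in> card ` {K. K \<subseteq> V \<and> clique K E}"
    using assms by (metis (mono_tags, lifting) imageI mem_Collect_eq)
next
  fix m assume "m \<in> card ` {K. K \<subseteq> V \<and> clique K E}"
  then obtain L where L: "L \<subseteq> V" "clique L E" "m = card L" by auto
  obtain f where f: "f \<in> proper_colourings V E (chromatic_number V E)"
    using proper_colourings_chromatic_number[OF simple_graph_axioms] by blast
  have "inj_on f L"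
    using f L(2) unfolding proper_colourings_def clique_def inj_on_def by blast
  moreover have "f ` L \<subseteq> {..<chromatic_number V E}"
    using f L(1) by (auto simp: proper_colourings_def)
  ultimately show "m \<le> chromatic_number V E"
    using card_inj_on_le[of f L "{..<chromatic_number V E}"] L(3) by simp
qed

section \<open>Lower bound for the number of edges\<close>

text \<open>Handshake count: incidences of vertices of \<open>U\<close> with edges inside
  \<open>U\<close> are counted in two ways.\<close>

lemma two_card_induced_edges:
  assumes "U \<subseteq> V"
  shows "2 * card {e \<in> E. e \<subseteq> U} = (\<Sum>v\<in>U. card {w \<in> U. {v, w} \<in> E})"
proof -
  have finU: "finite U" using assms finite_verts by (rule finite_subset)
  have "2 * card {e \<in> E. e \<subseteq> U} = (\<Sum>v\<in>U. card {e \<in> {e \<in> E. e \<subseteq> U}. v \<in> e})"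
  proof (rule sum_multicount[symmetric])
    show "\<forall>e\<in>{e \<in> E. e \<subseteq> U}. card {v \<in> U. v \<in> e} = 2"
    proof
      fix e assume e: "e \<in> {e \<in> E. e \<subseteq> U}"
      then have "{v \<in> U. v \<in> e} = e" by auto
      then show "card {v \<in> U. v \<in> e} = 2" using e edges_doubletons by auto
    qed
  qed (use finU finite_edges in auto)
  also have "\<dots> = (\<Sum>v\<in>U. card {w \<in> U. {v, w} \<in> E})"
  proof (rule sum.cong[OF refl])
    fix v assume v: "v \<in> U"
    have "bij_betw (\<lambda>w. {v, w}) {w \<in> U. {v, w} \<in> E} {e \<in> {e \<in> E. e \<subseteq> U}. v \<in> e}"
    proof (rule bij_betw_imageI)
      show "inj_on (\<lambda>w. {v, w}) {w \<in> U. {v, w} \<in> E}"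
        by (auto simp: inj_on_def doubleton_eq_iff)
      have "e \<in> (\<lambda>w. {v, w}) ` {w \<in> U. {v, w} \<in> E}" if "e \<in> E" "e \<subseteq> U" "v \<in> e" for e
      proof -
        have "card e = 2" using edges_doubletons that by auto
        then obtain w where "e = {v, w}" using \<open>v \<in> e\<close> by (auto simp: card_2_iff)
        then show ?thesis using that by auto
      qed
      then show "(\<lambda>w. {v, w}) ` {w \<in> U. {v, w} \<in> E} = {e \<in> {e \<in> E. e \<subseteq> U}. v \<in> e}"
        using v by auto
    qed
    then show "card {e \<in> {e \<in> E. e \<subseteq> U}. v \<in> e} = card {w \<in> U. {v, w} \<in> E}"
      by (simp add: bij_betw_same_card)
  qed
  finally show ?thesis .
qed

text \<open>The witness is a minimal set of vertices whose induced subgraph is not \<open>q\<close>-colourable.\<close>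

lemma min_degree_subgraph:
  assumes "proper_colourings V E q = {}"
  obtains U where "U \<subseteq> V" "U \<noteq> {}" "\<And>v. v \<in> U \<Longrightarrow> q \<le> card {w \<in> U. {v, w} \<in> E}"
proof -
  let ?bad = "\<lambda>U. U \<subseteq> V \<and> proper_colourings U {e \<in> E. e \<subseteq> U} q = {}"
  have "{e \<in> E. e \<subseteq> V} = E" using edges_doubletons by auto
  then have "?bad V" using assms by simp
  then obtain U where U: "?bad U" and minU: "\<And>W. ?bad W \<Longrightarrow> card U \<le> card W"
    using ex_has_least_nat[of ?bad V card] by blast
  have finU: "finite U" using U finite_verts finite_subset by blast
  show thesis
  proof
    show "U \<subseteq> V" using U by blast
    \<comment> \<open>The empty graph is colourable even with no colours, by the only extensional
      function on the empty set.\<close>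
    have "(\<lambda>_. undefined) \<in> proper_colourings {} {e \<in> E. e \<subseteq> {}} q"
      using edgeD by (auto simp: proper_colourings_def)
    then show "U \<noteq> {}" using U by blast
  next
    fix v assume v: "v \<in> U"
    let ?N = "{w \<in> U. {v, w} \<in> E}" and ?W = "U - {v}"
    show "q \<le> card ?N"
    proof (rule ccontr)
      assume deg: "\<not> q \<le> card ?N"
      have "card ?W < card U" using v finU by (rule card_Diff1_less[rotated])
      then have "\<not> ?bad ?W" using minU[of ?W] by linarith
      then obtain f where f: "f \<in> proper_colourings ?W {e \<in> E. e \<subseteq> ?W} q"
        using U by auto
      \<comment> \<open>The neighbours of \<open>v\<close> use fewer than \<open>q\<close> colours,
        so a free colour extends \<open>f\<close> to all of \<open>U\<close>, against the choice of
        \<open>U\<close>.\<close>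
      have "card (f ` ?N) < card {..<q}"
        using deg card_image_le[of ?N f] finU by simp
      then have "\<not> {..<q} \<subseteq> f ` ?N"
        using card_mono[of "f ` ?N" "{..<q}"] finU by auto
      then obtain c where c: "c < q" "c \<notin> f ` ?N" by auto
      have fr: "f \<in> ?W \<rightarrow>\<^sub>E {..<q}"
        and fp: "\<And>a b. {a, b} \<in> E \<Longrightarrow> a \<in> ?W \<Longrightarrow> b \<in> ?W \<Longrightarrow> f a \<noteq> f b"
        using f unfolding proper_colourings_def by auto
      have r: "f(v := c) \<in> U \<rightarrow>\<^sub>E {..<q}"
        using fr c(1) v by (auto simp: PiE_def Pi_def extensional_def)
      have p: "(f(v := c)) a \<noteq> (f(v := c)) b" if ab: "{a, b} \<in> E" "a \<in> U" "b \<in> U" for a b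
      proof -
        have "a \<noteq> b" using edgeD[OF ab(1)] by blast
        moreover have "{b, a} \<in> E" using ab by (simp add: insert_commute)
        ultimately show ?thesis using fp[of a b] ab c(2) by auto
      qed
      have "f(v := c) \<in> proper_colourings U {e \<in> E. e \<subseteq> U} q"
        using r p by (auto simp: proper_colourings_def simp del: fun_upd_apply)
      then show False using U by blast
    qed
  qed
qed

text \<open>Grow \<open>U\<close> one vertex at a time. By connectedness some edge joins
  \<open>U\<close> to a new vertex, and this edge is no longer counted once that vertex has been
  added.\<close>

lemma connected_edges_outside:
  assumes "connected_graph V E" "U \<subseteq> V" "U \<noteq> {}"
  shows "card (V - U) \<le> card {e \<in> E. \<not> e \<subseteq> U}"
  using assms(2,3)
proof (induction "card (V - U)" arbitrary: U)
  case 0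
  then show ?case by simp
next
  case (Suc m)
  from Suc.hyps(2) obtain b where b: "b \<in> V" "b \<notin> U"
    by (metis DiffD1 DiffD2 card.empty ex_in_conv nat.distinct(1))
  obtain a where a: "a \<in> U" using Suc.prems by blast
  have path: "(a, b) \<in> {(a, b). {a, b} \<in> E}\<^sup>*"
    using assms(1) a b Suc.prems by (auto simp: connected_graph_def)
  have "\<exists>u v. u \<in> U \<and> v \<notin> U \<and> {u, v} \<in> E"
  proof (rule ccontr)
    assume none: "\<not> ?thesis"
    from path have "b \<in> U"
      by (induction rule: rtrancl_induct) (use a none in auto)
    then show False using b by blast
  qed
  then obtain u v where uv: "u \<in> U" "v \<notin> U" "{u, v} \<in> E" by blast
  have v: "v \<in> V" using edgeD[OF uv(3)] by blast
  have "V - U = insert v (V - insert v U)" using uv v by auto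
  then have "card (V - U) = Suc (card (V - insert v U))"
    using finite_verts by (metis Diff_iff card_insert_disjoint finite_Diff insertI1)
  then have "card (V - insert v U) \<le> card {e \<in> E. \<not> e \<subseteq> insert v U}"
    using Suc.hyps Suc.prems v by auto
  moreover have "card {e \<in> E. \<not> e \<subseteq> insert v U} < card {e \<in> E. \<not> e \<subseteq> U}"
  proof (rule psubset_card_mono)
    show "finite {e \<in> E. \<not> e \<subseteq> U}" using finite_edges by simp
    have "{u, v} \<in> {e \<in> E. \<not> e \<subseteq> U}" "{u, v} \<notin> {e \<in> E. \<not> e \<subseteq> insert v U}"
      using uv by auto
    then show "{e \<in> E. \<not> e \<subseteq> insert v U} \<subset> {e \<in> E. \<not> e \<subseteq> U}" by blast
  qed
  ultimately show ?case
    using \<open>card (V - U) = Suc (card (V - insert v U))\<close> by linarith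
qed

text \<open>Inside the critical set \<open>U\<close> the degrees are at least \<open>k - 1\<close>,
  and each vertex outside costs one further edge. If \<open>card U = k\<close>, then
  \<open>U\<close> is a clique and equality would put the graph in \<open>Cstar\<close>; a larger
  \<open>U\<close> makes the count itself strict.\<close>

lemma card_edges_gt_of_not_Cstar:
  assumes "connected_graph V E" and k: "chromatic_number V E = k" "k \<ge> 4"
    and nC: "(V, E) \<notin> Cstar k (card V)"
  shows "(k choose 2) + card V - k < card E"
proof -
  have "proper_colourings V E (k - 1) = {}"
    using k not_less_Least[of "k - 1" "\<lambda>q. proper_colourings V E q \<noteq> {}"]
    unfolding chromatic_number_def by auto
  then obtain U where U: "U \<subseteq> V" "U \<noteq> {}"
    and deg: "\<And>v. v \<in> U \<Longrightarrow> k - 1 \<le> card {w \<in> U. {v, w} \<in> E}"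
    using min_degree_subgraph by blast
  have finU: "finite U" using U finite_verts finite_subset by blast
  have sub: "{w \<in> U. {v, w} \<in> E} \<subseteq> U - {v}" for v using edgeD(3) by auto
  have h: "k \<le> card U"
  proof -
    obtain v where v: "v \<in> U" using U by blast
    have "k - 1 \<le> card (U - {v})"
      using deg[OF v] card_mono[OF _ sub] finU by (meson finite_Diff le_trans)
    moreover have "card U > 0" using v finU by (auto simp: card_gt_0_iff)
    ultimately show ?thesis using v finU by simp
  qed
  have "(\<Sum>v\<in>U. k - 1) \<le> (\<Sum>v\<in>U. card {w \<in> U. {v, w} \<in> E})"
    by (intro sum_mono deg)
  then have inner: "(k - 1) * card U \<le> 2 * card {e \<in> E. e \<subseteq> U}"
    using two_card_induced_edges[OF U(1)] by (simp add: mult.commute)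
  have outer: "card V - card U \<le> card {e \<in> E. \<not> e \<subseteq> U}"
    using connected_edges_outside[OF assms(1) U] U finU by (simp add: card_Diff_subset)
  have cVU: "card U \<le> card V" using U finite_verts by (simp add: card_mono)
  have "E = {e \<in> E. e \<subseteq> U} \<union> {e \<in> E. \<not> e \<subseteq> U}" by auto
  then have "card E = card {e \<in> E. e \<subseteq> U} + card {e \<in> E. \<not> e \<subseteq> U}"
    by (metis (no_types, lifting) card_Un_disjoint finite_edges finite_Un disjoint_iff mem_Collect_eq)
  then have cE: "(k - 1) * card U + 2 * card V \<le> 2 * card E + 2 * card U"
    using inner outer cVU by linarith
  \<comment> \<open>With \<open>card U = k + d\<close>, the bound \<open>cE\<close> exceeds twice
    the target by \<open>(k - 3) * d = (l + 1) * d\<close>, which is positive for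
    \<open>d > 0\<close>.\<close>
  obtain l where l: "k = l + 4" using k(2) by (metis add.commute le_Suc_ex)
  obtain d where d: "card U = k + d" using h le_Suc_ex by blast
  have k2: "2 * (k choose 2) = k * (k - 1)" by (rule two_times_choose_two)
  show ?thesis
  proof (cases "card U = k")
    case True
    have "{w \<in> U. {v, w} \<in> E} = U - {v}" if "v \<in> U" for v
      using deg[OF that] that finU True by (intro card_seteq sub) auto
    then have "clique U E" by (auto simp: clique_def)
    then have "clique_number V E = k" using clique_number_eqI[OF _ U(1)] True k by auto
    then have "card E \<noteq> (k choose 2) + card V - k"
      using nC assms(1) k simple_graph_axioms by (auto simp: Cstar_def)
    moreover have "(k choose 2) + card V \<le> card E + k"
      using cE k2 True by (simp add: mult.commute)
    ultimately show ?thesis by linarith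
  next
    case False
    then have "d > 0" using d by simp
    then have "2 * (k choose 2) + 2 * card V < 2 * card E + 2 * k"
      using cE k2 unfolding d l by (simp add: algebra_simps)
    then show ?thesis using cVU h by linarith
  qed
qed

end

section \<open>Estimates for falling factorials\<close>

lemma falling_factorial_Suc: "falling_factorial x (Suc m) = falling_factorial x m * (x - real m)"
  by (simp add: falling_factorial_def)

text \<open>Lets the factor \<open>falling_factorial x k\<close> be cancelled from every term of the
  expansion.\<close>

lemma falling_factorial_add:
  "falling_factorial x (k + m) = falling_factorial x k * falling_factorial (x - real k) m"
  by (induction m) (auto simp: falling_factorial_def algebra_simps)

lemma falling_factorial_pos: "real m - 1 < x \<Longrightarrow> 0 < falling_factorial x m"
  unfolding falling_factorial_def by (intro prod_pos) auto

lemma falling_factorial_nonneg: "real m - 1 \<le> x \<Longrightarrow> 0 \<le> falling_factorial x m"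
  unfolding falling_factorial_def by (intro prod_nonneg) auto

text \<open>Truncated subtraction is harmless: for \<open>m > q\<close> both products contain the
  zero factor at \<open>i = q\<close>.\<close>

lemma falling_factorial_of_nat:
  "falling_factorial (real q) m = real (\<Prod>i<m. q - i)"
proof (cases "m \<le> q")
  case True
  then show ?thesis by (auto simp: falling_factorial_def of_nat_diff intro!: prod.cong)
next
  case False
  then have "falling_factorial (real q) m = 0" "(\<Prod>i<m. q - i) = 0"
    by (auto simp: falling_factorial_def intro!: bexI[of _ q])
  then show ?thesis by simp
qed

text \<open>The two leading terms of the expansion of \<open>(x - 1) ^ r\<close> in falling factorials of \<open>x - k\<close>.\<close>

lemma power_ge_falling_factorials:
  fixes k r :: nat
  assumes "real (k + r) \<le> x" "k \<ge> 1"
  shows "falling_factorial (x - real k) (Suc r)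
    + (real (k + Suc r choose 2) - real (k choose 2) - real (Suc r)) * falling_factorial (x - real k) r
    \<le> (x - 1) ^ Suc r"
  using assms(1)
proof (induction r)
  case 0
  have "(Suc k choose 2) = k + (k choose 2)" by (simp add: numeral_2_eq_2)
  then show ?case by (simp add: falling_factorial_def)
next
  case (Suc r)
  define N where "N s = real (k + s choose 2) - real (k choose 2) - real s" for s
  \<comment> \<open>This recurrence comes from \<open>x - 1 = (x - k - s) + (k + s - 1)\<close>:
    multiplying \<open>P s\<close> by \<open>x - 1\<close> gives \<open>P (Suc s)\<close> plus
    \<open>k + s - 1\<close> copies of \<open>P s\<close>.\<close>
  have NS: "N (Suc s) = N s + real (k + s) - 1" for s
    by (simp add: N_def numeral_2_eq_2)
  have N: "0 \<le> N s" for s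
    using assms(2) by (induction s) (auto simp: NS, simp add: N_def)
  define P where "P = falling_factorial (x - real k)"
  have PS: "P (Suc s) = P s * (x - real k - real s)" for s
    by (simp add: P_def falling_factorial_Suc)
  have P: "0 \<le> P r"
    unfolding P_def using Suc.prems by (intro falling_factorial_nonneg) auto
  have "P (Suc (Suc r)) + N (Suc (Suc r)) * P (Suc r) =
      (x - 1) * P (Suc r) + N (Suc r) * P r * (x - real k - real r)"
    unfolding PS[of "Suc r"] NS[of "Suc r"] PS[of r] by (simp add: algebra_simps)
  \<comment> \<open>Enlarging the factor \<open>x - k - r\<close> to \<open>x - 1\<close> lets
    \<open>x - 1\<close> be pulled out for the induction hypothesis.\<close>
  also have "\<dots> \<le> (x - 1) * P (Suc r) + N (Suc r) * P r * (x - 1)"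
    using N P assms(2) by (intro add_left_mono mult_left_mono) auto
  also have "\<dots> = (x - 1) * (P (Suc r) + N (Suc r) * P r)" by (simp add: algebra_simps)
  also have "\<dots> \<le> (x - 1) * (x - 1) ^ Suc r"
    using Suc assms(2) unfolding P_def N_def by (intro mult_left_mono) auto
  finally show ?case unfolding P_def N_def by simp
qed

text \<open>Each step in \<open>j\<close> multiplies the binomial by at most \<open>M\<close>, and
  \<open>2 * M\<close> is at most the square of \<open>M + 1\<close>. The powers of 2 later produce
  a geometric series.\<close>

lemma two_power_times_binomial_le: "2 ^ Suc j * (M choose Suc (Suc j)) \<le> ((M + 1)\<^sup>2) ^ Suc j"
proof (induction j)
  case 0
  have "2 * (M choose 2) = M * (M - 1)" by (rule two_times_choose_two)
  also have "\<dots> \<le> (M + 1) * (M + 1)" by (intro mult_mono) auto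
  finally show ?case by (simp add: power2_eq_square numeral_2_eq_2)
next
  case (Suc j)
  have "(M choose Suc (Suc (Suc j))) \<le> M * (M choose Suc (Suc j))"
  proof (cases "Suc (Suc (Suc j)) \<le> M")
    case True
    have "1 * (M choose Suc (Suc (Suc j))) \<le> Suc (Suc (Suc j)) * (M choose Suc (Suc (Suc j)))"
      by (intro mult_mono) auto
    also have "\<dots> = (M - Suc (Suc j)) * (M choose Suc (Suc j))"
      by (metis binomial_absorption binomial_absorb_comp)
    also have "\<dots> \<le> M * (M choose Suc (Suc j))" by (intro mult_right_mono) auto
    finally show ?thesis by simp
  qed (simp add: binomial_eq_0)
  then have "2 ^ Suc (Suc j) * (M choose Suc (Suc (Suc j)))
      \<le> 2 ^ Suc (Suc j) * (M * (M choose Suc (Suc j)))"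
    by (intro mult_left_mono) auto
  also have "\<dots> = (2 * M) * (2 ^ Suc j * (M choose Suc (Suc j)))" by simp
  also have "\<dots> \<le> (M + 1)\<^sup>2 * ((M + 1)\<^sup>2) ^ Suc j"
    by (intro mult_mono Suc) (auto simp: power2_eq_square)
  finally show ?case by simp
qed

text \<open>Each of the last \<open>j\<close> factors of \<open>falling_factorial z (m + j)\<close>
  is at least \<open>y\<close>.\<close>

lemma falling_factorial_ge_power_mult:
  assumes "real (m + j) - 1 + y \<le> z" "0 \<le> y"
  shows "y ^ j * falling_factorial z m \<le> falling_factorial z (m + j)"
  using assms(1)
proof (induction j)
  case (Suc j)
  have "0 \<le> falling_factorial z (m + j)"
    using Suc.prems assms(2) by (intro falling_factorial_nonneg) auto
  then have "(y ^ j * falling_factorial z m) * y \<le> falling_factorial z (m + j) * (z - real (m + j))"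
    using Suc assms(2) by (intro mult_mono) auto
  then show ?case by (simp add: falling_factorial_Suc mult_ac)
qed simp

text \<open>The term with index \<open>j\<close> is at most \<open>falling_factorial z r\<close>
  divided by \<open>2 ^ Suc j\<close>, and these fractions sum to less than 1.\<close>

lemma binomial_falling_factorial_tail:
  fixes M r :: nat
  assumes y: "(real M + 1)\<^sup>2 < y" and z: "real r - 1 + y \<le> z"
  shows "(\<Sum>j<r. real (M choose Suc (Suc j)) * falling_factorial z (r - Suc j)) < falling_factorial z r"
proof -
  have y0: "0 \<le> y" using y by (smt (verit) zero_le_power2)
  have Pr: "0 < falling_factorial z r"
    using z y0 y by (intro falling_factorial_pos) (smt (verit) zero_le_power2)
  have "real (M choose Suc (Suc j)) * falling_factorial z (r - Suc j)
      \<le> falling_factorial z r * (1 / 2) ^ Suc j" if "j < r" for j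
  proof -
    have P0: "0 \<le> falling_factorial z (r - Suc j)"
      using z y0 that by (intro falling_factorial_nonneg) (auto simp: of_nat_diff)
    have "2 ^ Suc j * real (M choose Suc (Suc j)) = real (2 ^ Suc j * (M choose Suc (Suc j)))"
      by simp
    also have "\<dots> \<le> real (((M + 1)\<^sup>2) ^ Suc j)"
      using two_power_times_binomial_le by (rule of_nat_mono)
    also have "\<dots> = ((real M + 1)\<^sup>2) ^ Suc j" by (simp add: add.commute)
    also have "\<dots> \<le> y ^ Suc j" using y by (intro power_mono) auto
    finally have "2 ^ Suc j * real (M choose Suc (Suc j)) * falling_factorial z (r - Suc j)
        \<le> y ^ Suc j * falling_factorial z (r - Suc j)"
      using P0 by (rule mult_right_mono)
    also have "\<dots> \<le> falling_factorial z r"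
      using falling_factorial_ge_power_mult[of "r - Suc j" "Suc j" y z] that z y0 by simp
    finally show ?thesis by (simp add: field_simps)
  qed
  then have "(\<Sum>j<r. real (M choose Suc (Suc j)) * falling_factorial z (r - Suc j))
      \<le> (\<Sum>j<r. falling_factorial z r * (1 / 2) ^ Suc j)"
    by (intro sum_mono) auto
  also have "\<dots> = falling_factorial z r * (\<Sum>j<r. (1 / 2) ^ Suc j)"
    by (rule sum_distrib_left[symmetric])
  also have "(\<Sum>j<r. (1 / 2 :: real) ^ Suc j) = 1 - (1 / 2) ^ r"
    by (induction r) auto
  also have "falling_factorial z r * (1 - (1 / 2) ^ r) < falling_factorial z r"
    using Pr by (simp add: algebra_simps)
  finally show ?thesis .
qed

section \<open>Expansion of the chromatic polynomial in falling factorials\<close>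

lemma card_injective_colourings:
  assumes "finite V"
  shows "real (card {f \<in> V \<rightarrow>\<^sub>E {..<q}. inj_on f V}) = falling_factorial (real q) (card V)"
  using card_inj_on_subset_funcset[of V "{..<q}" V] assms
  by (simp add: falling_factorial_of_nat atLeast0LessThan)

text \<open>Colourings that separate \<open>u\<close> and \<open>v\<close> are those with the edge
  added; colourings that identify them are those of the graph with \<open>v\<close> merged into
  \<open>u\<close> by \<open>h\<close>.\<close>

lemma card_proper_colourings_add_contract:
  fixes V :: "'a set"
  assumes "simple_graph V E" and uv: "u \<in> V" "v \<in> V" "u \<noteq> v" "{u, v} \<notin> E"
  defines "h \<equiv> (\<lambda>w. if w = v then u else w)"
  shows "card (proper_colourings V E q) = card (proper_colourings V (insert {u, v} E) q)
    + card (proper_colourings (V - {v}) ((`) h ` E) q)"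
proof -
  interpret simple_graph V E by fact
  let ?C = "proper_colourings V E q"
  let ?A = "proper_colourings V (insert {u, v} E) q"
  let ?B = "proper_colourings (V - {v}) ((`) h ` E) q"
  let ?D = "{f \<in> ?C. f u = f v}"
  \<comment> \<open>Resetting \<open>v\<close> to \<open>undefined\<close> keeps functions
    extensional on \<open>V - {v}\<close>; the inverse copies the colour of \<open>u\<close> to
    \<open>v\<close>.\<close>
  have "bij_betw (\<lambda>f. f(v := undefined)) ?D ?B"
  proof (rule bij_betw_byWitness[where f' = "\<lambda>g. g(v := g u)"])
    show "\<forall>f\<in>?D. (f(v := undefined))(v := (f(v := undefined)) u) = f"
      using uv by (auto simp: fun_eq_iff)
    show "\<forall>g\<in>?B. (g(v := g u))(v := undefined) = g"
      by (auto simp: fun_eq_iff PiE_def extensional_def proper_colourings_def)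
    show "(\<lambda>f. f(v := undefined)) ` ?D \<subseteq> ?B"
    proof (rule image_subsetI)
      fix f assume f: "f \<in> ?D"
      have fh: "(f(v := undefined)) (h w) = f w" for w
        using f uv by (simp add: h_def)
      have "(f(v := undefined)) a \<noteq> (f(v := undefined)) b" if "{a, b} \<in> (`) h ` E" for a b
      proof -
        from that obtain e where e: "e \<in> E" "{a, b} = h ` e" by blast
        obtain c d where cd: "e = {c, d}" using edges_doubletons[OF e(1)] by (auto simp: card_2_iff)
        have "f c \<noteq> f d" using f e cd by (auto simp: proper_colourings_def)
        moreover have "a = h c \<and> b = h d \<or> a = h d \<and> b = h c"
          using e(2) unfolding cd by (auto simp: doubleton_eq_iff)
        ultimately show ?thesis by (metis fh)
      qed
      moreover have "f(v := undefined) \<in> V - {v} \<rightarrow>\<^sub>E {..<q}"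
        using f by (auto simp: PiE_def extensional_def Pi_def proper_colourings_def)
      ultimately show "f(v := undefined) \<in> ?B" unfolding proper_colourings_def by blast
    qed
    show "(\<lambda>g. g(v := g u)) ` ?B \<subseteq> ?D"
    proof (rule image_subsetI)
      fix g assume g: "g \<in> ?B"
      have gh: "(g(v := g u)) w = g (h w)" for w
        by (simp add: h_def)
      have "g (h a) \<noteq> g (h b)" if "{a, b} \<in> E" for a b
        using g imageI[OF that, of "(`) h"] unfolding proper_colourings_def by auto
      then have "\<forall>a b. {a, b} \<in> E \<longrightarrow> (g(v := g u)) a \<noteq> (g(v := g u)) b"
        unfolding gh by blast
      moreover have "g(v := g u) \<in> V \<rightarrow>\<^sub>E {..<q}"
        using g uv by (auto simp: PiE_def extensional_def Pi_def proper_colourings_def)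
      moreover have "(g(v := g u)) u = (g(v := g u)) v" by simp
      ultimately show "g(v := g u) \<in> ?D" unfolding proper_colourings_def by blast
    qed
  qed
  then have card_D: "card ?D = card ?B" by (rule bij_betw_same_card)
  have finC: "finite ?C"
    unfolding proper_colourings_def
    by (rule finite_subset[OF _ finite_PiE[OF finite_verts, of "\<lambda>_. {..<q}"]]) auto
  have C: "?C = ?A \<union> ?D"
    unfolding proper_colourings_def by (auto simp: doubleton_eq_iff)
  have disj: "?A \<inter> ?D = {}"
    unfolding proper_colourings_def by auto
  have "?A \<subseteq> ?C" "?D \<subseteq> ?C"
    unfolding proper_colourings_def by auto
  then have "card (?A \<union> ?D) = card ?A + card ?D"
    using finC by (intro card_Un_disjoint[OF _ _ disj]) (rule finite_subset, assumption+)+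
  with arg_cong[OF C, of card] have "card ?C = card ?A + card ?D" by (rule trans)
  then show ?thesis unfolding card_D .
qed

text \<open>
  The coefficient \<open>a j\<close> is the number of partitions of the vertices into \<open>card V - j\<close>
  independent sets. Each part can be spanned by a tree of non-edges, which explains the
  bound on \<open>a j\<close>; the induction instead uses addition and contraction of a non-edge.
\<close>

lemma proper_colourings_expansion:
  fixes V :: "'a set"
  assumes "simple_graph V E" "card {e. e \<subseteq> V \<and> card e = 2 \<and> e \<notin> E} \<le> M"
  shows "\<exists>a :: nat \<Rightarrow> nat. (\<forall>j. a j \<le> M choose j) \<and> (\<forall>q. real (card (proper_colourings V E q)) =
     (\<Sum>j\<le>card V. real (a j) * falling_factorial (real q) (card V - j)))"
  using assms
proof (induction M arbitrary: V E)
  case (0 V E)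
  interpret simple_graph V E by fact
  have "finite {e. e \<subseteq> V \<and> card e = 2 \<and> e \<notin> E}"
    using finite_verts by (auto intro: rev_finite_subset[of "Pow V"])
  then have none: "{e. e \<subseteq> V \<and> card e = 2 \<and> e \<notin> E} = {}"
    using 0 by simp
  have all: "{a, b} \<in> E" if "a \<in> V" "b \<in> V" "a \<noteq> b" for a b
    using none that by (auto dest: equals0D[of _ "{a, b}"])
  \<comment> \<open>The graph is complete, so only the term \<open>j = 0\<close> occurs.\<close>
  have "proper_colourings V E q = {f \<in> V \<rightarrow>\<^sub>E {..<q}. inj_on f V}" for q
  proof -
    have "(\<forall>a b. {a, b} \<in> E \<longrightarrow> f a \<noteq> f b) \<longleftrightarrow> inj_on f V" for f :: "'a \<Rightarrow> nat"
      using all edgeD unfolding inj_on_def by blast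
    then show ?thesis unfolding proper_colourings_def by simp
  qed
  moreover have "(\<Sum>j\<le>card V. real (if j = 0 then 1 else 0) * falling_factorial (real q) (card V - j))
      = falling_factorial (real q) (card V)" for q
    by (subst sum.remove[of _ 0]) auto
  ultimately show ?case
    using card_injective_colourings[OF finite_verts]
    by (intro exI[of _ "\<lambda>j. if j = 0 then 1 else 0"]) simp
next
  case (Suc M V E)
  interpret simple_graph V E by fact
  let ?N = "\<lambda>V E. {e. e \<subseteq> V \<and> card e = 2 \<and> e \<notin> E}"
  have fin: "finite (?N V E)"
    using finite_verts by (auto intro: rev_finite_subset[of "Pow V"])
  show ?case
  proof (cases "?N V E = {}")
    case True
    \<comment> \<open>\<open>Suc M\<close> is only an upper bound, so a complete graph can occur
      here as well.\<close>
    have "card (?N V E) \<le> M" unfolding True by simp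
    from Suc.IH[OF Suc.prems(1) this] obtain a where a: "\<forall>j. a j \<le> M choose j"
      "\<forall>q. real (card (proper_colourings V E q)) =
         (\<Sum>j\<le>card V. real (a j) * falling_factorial (real q) (card V - j))"
      by blast
    have "M choose j \<le> Suc M choose j" for j by (cases j) auto
    then have "\<forall>j. a j \<le> Suc M choose j" using a(1) le_trans by blast
    then show ?thesis using a(2) by blast
  next
    case False
    then obtain u v where uv: "u \<in> V" "v \<in> V" "u \<noteq> v" "{u, v} \<notin> E"
      by (auto simp: card_2_iff)
    then have uvN: "{u, v} \<in> ?N V E" by auto
    define h where "h = (\<lambda>w. if w = v then u else w)"
    have g1: "simple_graph V (insert {u, v} E)"
      using finite_verts edges_doubletons uv by unfold_locales auto
    have g2: "simple_graph (V - {v}) ((`) h ` E)"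
    proof
      fix e assume "e \<in> (`) h ` E"
      then obtain e' where e': "e' \<in> E" "e = h ` e'" by blast
      then obtain c d where "e' = {c, d}" using edges_doubletons by (meson card_2_iff)
      then have cd: "e = h ` {c, d}" "{c, d} \<in> E" using e' by auto
      have "{d, c} \<in> E" using cd by (simp add: insert_commute)
      \<comment> \<open>Merging creates no loop because \<open>u\<close> and \<open>v\<close> are
        not adjacent.\<close>
      then have "h c \<noteq> h d" using edgeD(3) cd(2) uv(4) unfolding h_def by metis
      moreover have "h c \<in> V - {v}" "h d \<in> V - {v}"
        using uv edgeD[OF cd(2)] by (simp_all add: h_def)
      ultimately show "e \<subseteq> V - {v} \<and> card e = 2" using cd(1) by simp
    qed (use finite_verts in auto)
    have c: "card (?N V E - {{u, v}}) \<le> M" using fin uvN Suc.prems(2) by simp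
    have "?N V (insert {u, v} E) \<subseteq> ?N V E - {{u, v}}" by auto
    then have n1: "card (?N V (insert {u, v} E)) \<le> M"
      using c card_mono[of "?N V E - {{u, v}}"] fin by (meson finite_Diff le_trans)
    \<comment> \<open>A non-edge of the merged graph avoids \<open>v\<close>, so \<open>h\<close>
      fixes it and it was already a non-edge other than \<open>{u, v}\<close>.\<close>
    have "?N (V - {v}) ((`) h ` E) \<subseteq> ?N V E - {{u, v}}"
    proof
      fix e assume e: "e \<in> ?N (V - {v}) ((`) h ` E)"
      then have "v \<notin> e" by auto
      then have "h ` e = e" by (auto simp: h_def)
      then have "e \<notin> E" using e by (metis (mono_tags, lifting) imageI mem_Collect_eq)
      then show "e \<in> ?N V E - {{u, v}}" using e by auto
    qed
    then have n2: "card (?N (V - {v}) ((`) h ` E)) \<le> M"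
      using c card_mono[of "?N V E - {{u, v}}"] fin by (meson finite_Diff le_trans)
    from Suc.IH[OF g1 n1] obtain a where
      a: "\<forall>j. a j \<le> M choose j" "\<forall>q. real (card (proper_colourings V (insert {u, v} E) q)) =
        (\<Sum>j\<le>card V. real (a j) * falling_factorial (real q) (card V - j))"
      by blast
    from Suc.IH[OF g2 n2] obtain b where
      b: "\<forall>j. b j \<le> M choose j" "\<forall>q. real (card (proper_colourings (V - {v}) ((`) h ` E) q)) =
        (\<Sum>j\<le>card (V - {v}). real (b j) * falling_factorial (real q) (card (V - {v}) - j))"
      by blast
    \<comment> \<open>Merging loses one vertex, so its coefficients are shifted by one; Pascal's
      rule then gives the bound.\<close>
    define a' where "a' j = a j + (case j of 0 \<Rightarrow> 0 | Suc i \<Rightarrow> b i)" for j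
    have "a' j \<le> Suc M choose j" for j
    proof (cases j)
      case 0
      then show ?thesis using a(1)[rule_format, of 0] by (simp add: a'_def)
    next
      case (Suc i)
      then show ?thesis using add_mono[of "b i" "M choose i" "a j" "M choose j"] a(1) b(1)
        by (simp add: a'_def)
    qed
    moreover have "real (card (proper_colourings V E q)) =
        (\<Sum>j\<le>card V. real (a' j) * falling_factorial (real q) (card V - j))" for q
    proof -
      have n: "card V = Suc (card (V - {v}))"
        using uv(2) finite_verts by (metis card_Suc_Diff1)
      have "(\<Sum>j\<le>card V. real (case j of 0 \<Rightarrow> 0 | Suc i \<Rightarrow> b i) * falling_factorial (real q) (card V - j))
          = real (card (proper_colourings (V - {v}) ((`) h ` E) q))"
        unfolding b(2)[rule_format] n by (subst sum.atMost_Suc_shift) simp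
      then have "(\<Sum>j\<le>card V. real (a' j) * falling_factorial (real q) (card V - j)) =
          real (card (proper_colourings V (insert {u, v} E) q))
          + real (card (proper_colourings (V - {v}) ((`) h ` E) q))"
        unfolding a(2)[rule_format] by (simp add: a'_def distrib_right sum.distrib)
      then show ?thesis
        using card_proper_colourings_add_contract[OF Suc.prems(1) uv, of q] by (simp add: h_def)
    qed
    ultimately show ?thesis by blast
  qed
qed

lemma poly_falling_factorial_ex: "\<exists>p. \<forall>x. poly p x = falling_factorial x m"
  by (intro exI[of _ "\<Prod>i<m. [:- real i, 1:]"]) (simp add: falling_factorial_def poly_prod)

text \<open>
  Terms of the expansion with fewer than \<open>k\<close> independent sets vanish because they are
  nonnegative and sum to the number of colourings with \<open>k - 1\<close> colours.
\<close>

lemma chromatic_poly_expansion: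
  fixes V :: "'a set"
  assumes G: "simple_graph V E" and k: "chromatic_number V E = k"
    and M: "card {e. e \<subseteq> V \<and> card e = 2 \<and> e \<notin> E} \<le> M"
  obtains a :: "nat \<Rightarrow> nat" where "\<And>j. a j \<le> M choose j"
    and "\<And>x. poly (chromatic_poly V E) x =
      (\<Sum>j | k + j \<le> card V. real (a j) * falling_factorial x (card V - j))"
proof -
  obtain a where a: "\<forall>j. a j \<le> M choose j"
    and aq: "\<forall>q. real (card (proper_colourings V E q)) =
      (\<Sum>j\<le>card V. real (a j) * falling_factorial (real q) (card V - j))"
    using proper_colourings_expansion[OF G M] by blast
  have a0: "a j = 0" if j: "j \<le> card V" "\<not> k + j \<le> card V" for j
  proof -
    have "proper_colourings V E (k - 1) = {}"
      using j k not_less_Least[of "k - 1" "\<lambda>q. proper_colourings V E q \<noteq> {}"]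
      unfolding chromatic_number_def by auto
    then have "(\<Sum>j\<le>card V. real (a j) * falling_factorial (real (k - 1)) (card V - j)) = 0"
      using aq by (metis card.empty of_nat_0)
    moreover have "0 \<le> falling_factorial (real (k - 1)) m" for m
      unfolding falling_factorial_of_nat by (rule of_nat_0_le_iff)
    ultimately have "real (a j) * falling_factorial (real (k - 1)) (card V - j) = 0"
      using j(1) by (subst (asm) sum_nonneg_eq_0_iff) auto
    \<comment> \<open>Here \<open>card V - j\<close> is at most \<open>k - 1\<close>, so the
      vanishing product forces \<open>a j = 0\<close>.\<close>
    moreover have "0 < falling_factorial (real (k - 1)) (card V - j)"
      using j by (intro falling_factorial_pos) linarith
    ultimately show ?thesis by simp
  qed
  obtain p where p: "\<And>m x. poly (p m) x = falling_factorial x m"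
    using poly_falling_factorial_ex by metis
  \<comment> \<open>Agreement at all natural numbers carries the colour count over to an identity of
    polynomials, hence to real arguments.\<close>
  have "chromatic_poly V E = (\<Sum>j\<le>card V. smult (real (a j)) (p (card V - j)))"
    by (rule poly_eq_of_nat_values) (simp add: poly_chromatic_poly[OF G] aq poly_sum p)
  then have "poly (chromatic_poly V E) x =
      (\<Sum>j\<le>card V. real (a j) * falling_factorial x (card V - j))" for x
    by (simp add: poly_sum p)
  also have "(\<Sum>j\<le>card V. real (a j) * falling_factorial x (card V - j)) =
      (\<Sum>j | k + j \<le> card V. real (a j) * falling_factorial x (card V - j))" for x
    using a0 by (intro sum.mono_neutral_right) auto
  finally show thesis using that a by blast
qed

section \<open>Comparison of the two expansions\<close>

theorem theorem8:
  fixes k n :: nat and V :: "'a set" and E :: "'a set set" and x :: real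
  assumes "k \<ge> 4" and "n \<ge> k"
    and "simple_graph V E"
    and "connected_graph V E"
    and "chromatic_number V E = k"
    and "card V = n"
    and "(V, E) \<notin> Cstar k n"
    and "x > real n - 2 + (real (n choose 2) - real (k choose 2) - real n + real k)\<^sup>2"
  shows "1 / falling_factorial x k * poly (chromatic_poly V E) x < (x - 1) ^ (n - k)"
proof -
  interpret simple_graph V E by fact
  define N where "N = real (n choose 2) - real (k choose 2) - real n + real k"
  define M where "M = (n choose 2) - card E"
  have pairs: "card {e. e \<subseteq> V \<and> card e = 2} = n choose 2" "finite {e. e \<subseteq> V \<and> card e = 2}"
    using n_subsets[OF finite_verts] finite_verts assms(6) by auto
  have sub: "E \<subseteq> {e. e \<subseteq> V \<and> card e = 2}" using edges_doubletons by auto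
  then have cE: "card E \<le> n choose 2" using card_mono[OF pairs(2)] pairs(1) by simp
  have "{e. e \<subseteq> V \<and> card e = 2 \<and> e \<notin> E} = {e. e \<subseteq> V \<and> card e = 2} - E" by auto
  then have M: "card {e. e \<subseteq> V \<and> card e = 2 \<and> e \<notin> E} \<le> M"
    using card_Diff_subset[OF finite_edges sub] pairs by (simp add: M_def)
  have "(k choose 2) + n - k < card E"
    using card_edges_gt_of_not_Cstar assms by blast
  \<comment> \<open>\<open>N\<close> is the number of non-edges of a member of
    \<open>Cstar k n\<close>, and \<open>M\<close> that of the given graph; one surplus edge
    separates them.\<close>
  then have MN: "real M + 1 \<le> N"
    using cE assms(2) unfolding M_def N_def by linarith
  \<comment> \<open>For \<open>n = k\<close> one would have \<open>N = 0\<close>, contradicting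
    \<open>MN\<close>.\<close>
  obtain r where r: "n = k + Suc r"
  proof (cases "n = k")
    case True
    then show ?thesis using MN by (simp add: N_def)
  next
    case False
    then show ?thesis using that assms(2) by (metis add_Suc_right le_Suc_ex less_imp_Suc_add nat_less_le)
  qed
  \<comment> \<open>For \<open>r > 0\<close> this is the smallest factor of \<open>?P r\<close>,
    namely \<open>x - k - (r - 1)\<close>.\<close>
  define y where "y = x - real n + 2"
  have y: "N\<^sup>2 < y" using assms(8) by (simp add: y_def N_def)
  have "(real M + 1)\<^sup>2 \<le> N\<^sup>2" using MN by (intro power_mono) auto
  then have My: "(real M + 1)\<^sup>2 < y" using y by linarith
  then have y1: "1 < y" by (smt (verit) one_le_power of_nat_0_le_iff)
  let ?P = "falling_factorial (x - real k)"
  have P: "0 \<le> ?P m" if "m \<le> Suc r" for m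
    using y1 that unfolding y_def r by (intro falling_factorial_nonneg) auto
  have pk: "0 < falling_factorial x k"
    using y1 unfolding y_def r by (intro falling_factorial_pos) auto
  obtain a where a: "\<And>j. a j \<le> M choose j"
    and ax: "\<And>x. poly (chromatic_poly V E) x =
      (\<Sum>j | k + j \<le> card V. real (a j) * falling_factorial x (card V - j))"
    using chromatic_poly_expansion[OF assms(3,5) M] by blast
  have "falling_factorial x (n - j) = falling_factorial x k * ?P (Suc r - j)" if "j \<le> Suc r" for j
    using falling_factorial_add[of x k "Suc r - j"] that r by simp
  moreover have "{j. k + j \<le> card V} = {..Suc r}" using assms(6) r by auto
  ultimately have "poly (chromatic_poly V E) x =
      falling_factorial x k * (\<Sum>j\<le>Suc r. real (a j) * ?P (Suc r - j))"
    unfolding ax assms(6) sum_distrib_left by (auto intro!: sum.cong)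
  then have "1 / falling_factorial x k * poly (chromatic_poly V E) x =
      (\<Sum>j\<le>Suc r. real (a j) * ?P (Suc r - j))"
    using pk by simp
  also have "\<dots> \<le> (\<Sum>j\<le>Suc r. real (M choose j) * ?P (Suc r - j))"
    using a P by (intro sum_mono mult_right_mono) auto
  also have "\<dots> = ?P (Suc r) + (real M * ?P r
      + (\<Sum>j<r. real (M choose Suc (Suc j)) * ?P (r - Suc j)))"
    by (simp add: sum.atMost_Suc_shift sum.lessThan_Suc_shift flip: lessThan_Suc_atMost
        del: sum.lessThan_Suc sum.atMost_Suc binomial_Suc_Suc)
  \<comment> \<open>The whole tail costs less than one extra copy of \<open>?P r\<close>, which the
    gap between \<open>M\<close> and \<open>N\<close> pays for.\<close>
  also have "\<dots> < ?P (Suc r) + (real M * ?P r + ?P r)"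
    using binomial_falling_factorial_tail[OF My, of r "x - real k"] by (simp add: y_def r)
  also have "\<dots> = ?P (Suc r) + (real M + 1) * ?P r" by (simp add: algebra_simps)
  also have "\<dots> \<le> ?P (Suc r) + N * ?P r"
    using MN P by (intro add_left_mono mult_right_mono) auto
  also have "\<dots> \<le> (x - 1) ^ Suc r"
    using power_ge_falling_factorials[of k r x] assms(1) y1 by (simp add: N_def y_def r algebra_simps)
  finally show ?thesis using r by simp
qed

end
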